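(* Let $H$ be a separable infinite-dimensional Hilbert space, let $(\mathcal{M},\tau)$ be a finite von Neumann algebra acting on $H$, and let $V_0,\ldots,V_N\in L^0(\mathcal{M},\tau)$ be self-adjoint. Consider the control system $$i\hbar\frac{d}{dt}\xi(t)=\Big(V_0+\sum_{j=1}^N u_j(t)V_j\Big)\xi(t),\qquad \xi(0)=\xi_0,$$ with piecewise constant control functions $u_j:\mathbb{R}\to\mathbb{R}$. If $\mathcal{M}$ is not a factor, then this system is not pure state controllable.
   Context: A finite von Neumann algebra $(\mathcal{M},\tau)$ is a von Neumann algebra $\mathcal{M}\subseteq\mathcal{B}(H)$ (with unit $I_H$) together with a faithful normal tracial state $\tau$. $\mathcal{M}$ is a factor if $\mathcal{M}\cap\mathcal{M}'=\mathbb{C}I$. A closed densely defined operator $a$ on $H$ is affiliated with $\mathcal{M}$ if $ua=au$ for every unitary $u\in\mathcal{M}'$; $L^0(\mathcal{M},\tau)$ is the set of all such operators. It is a $*$-algebra with sum $\overline{a+b}$ and product $\overline{ab}$ (closures of the algebraic operations), and linear combinations of the $V_j$ are taken in it; for $y\in\mathbb{R}^N$, $V(y)=V_0+\sum_{j=1}^N y_jV_j$ is self-adjoint. Here $\hbar>0$ is a fixed constant. For piecewise constant controls (finitely many pieces on bounded intervals), the solution is $\xi(t)=u(t)\xi_0$, where $u(t)$ is the time-ordered product of the unitaries $e^{-\frac{i}{\hbar}sV(y)}$ with $s$ the length of each piece up to time $t$ and $y\in\mathbb{R}^N$ the value of the controls there. The system is pure state controllable if for any two unit vectors $\xi_0,\xi_f\in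 H$ there exist a control function and a time $T>0$ such that the solution with initial condition $\xi_0$ satisfies $\xi(T)=\xi_f$. *)

theory Defs
  imports "HOL-Analysis.Analysis"
begin

section \<open>Complex Hilbert spaces\<close>

text \<open>The inner product is linear in the second argument. Positive definiteness of \<open>cinner\<close>
  follows from \<open>norm_eq_sqrt_cinner\<close> and the norm axioms.\<close>

class complex_hilbert_space = banach +
  fixes scaleC :: "complex \<Rightarrow> 'a \<Rightarrow> 'a"  (infixr \<open>*\<^sub>C\<close> 75)
    and cinner :: "'a \<Rightarrow> 'a \<Rightarrow> complex"
  assumes scaleC_add_right: "c *\<^sub>C (x + y) = c *\<^sub>C x + c *\<^sub>C y"
    and scaleC_add_left: "(c + d) *\<^sub>C x = c *\<^sub>C x + d *\<^sub>C x"
    and scaleC_scaleC: "c *\<^sub>C d *\<^sub>C x = (c * d) *\<^sub>C x"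
    and scaleR_scaleC: "r *\<^sub>R x = complex_of_real r *\<^sub>C x"
    and cinner_commute: "cinner x y = cnj (cinner y x)"
    and cinner_add_right: "cinner x (y + z) = cinner x y + cinner x z"
    and cinner_scaleC_right: "cinner x (c *\<^sub>C y) = c * cinner x y"
    and norm_eq_sqrt_cinner: "norm x = sqrt (Re (cinner x x))"

definition infinite_dimensional :: "'a::complex_hilbert_space itself \<Rightarrow> bool" where
  "infinite_dimensional _ \<longleftrightarrow>
     \<not> (\<exists>B::'a set. finite B \<and> module.span scaleC B = UNIV)"


section \<open>Bounded operators and von Neumann algebras\<close>

definition bounded_clinear :: "('a::complex_hilbert_space \<Rightarrow> 'a) \<Rightarrow> bool" where
  "bounded_clinear f \<longleftrightarrow> bounded_linear f \<and> (\<forall>c x. f (c *\<^sub>C x) = c *\<^sub>C f x)"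

definition is_adjoint ::
  "('a::complex_hilbert_space \<Rightarrow> 'a) \<Rightarrow> ('a \<Rightarrow> 'a) \<Rightarrow> bool" where
  "is_adjoint f g \<longleftrightarrow> (\<forall>x y. cinner (f x) y = cinner x (g y))"

definition positive_op :: "('a::complex_hilbert_space \<Rightarrow> 'a) \<Rightarrow> bool" where
  "positive_op f \<longleftrightarrow> (\<forall>x. cinner x (f x) \<in> \<real>\<^sub>\<ge>\<^sub>0)"

definition op_le :: "('a::complex_hilbert_space \<Rightarrow> 'a) \<Rightarrow> ('a \<Rightarrow> 'a) \<Rightarrow> bool" where
  "op_le f g \<longleftrightarrow> positive_op (\<lambda>x. g x - f x)"

definition unitary_op :: "('a::complex_hilbert_space \<Rightarrow> 'a) \<Rightarrow> bool" where
  "unitary_op u \<longleftrightarrow>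
     bounded_clinear u \<and> surj u \<and> (\<forall>x y. cinner (u x) (u y) = cinner x y)"

definition commutant ::
  "('a::complex_hilbert_space \<Rightarrow> 'a) set \<Rightarrow> ('a \<Rightarrow> 'a) set" where
  "commutant M = {g. bounded_clinear g \<and> (\<forall>f\<in>M. f \<circ> g = g \<circ> f)}"

text \<open>Every commutant is a unital subalgebra, so the algebra operations and the unit are covered
  by the bicommutant condition.\<close>

definition von_neumann_algebra :: "('a::complex_hilbert_space \<Rightarrow> 'a) set \<Rightarrow> bool" where
  "von_neumann_algebra M \<longleftrightarrow>
     M \<subseteq> {f. bounded_clinear f} \<and>
     (\<forall>f\<in>M. \<exists>g\<in>M. is_adjoint f g) \<and>
     commutant (commutant M) = M"

definition factor :: "('a::complex_hilbert_space \<Rightarrow> 'a) set \<Rightarrow> bool" where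
  "factor M \<longleftrightarrow> M \<inter> commutant M = {(\<lambda>x. c *\<^sub>C x) | c. True}"

definition tracial_state ::
  "('a::complex_hilbert_space \<Rightarrow> 'a) set \<Rightarrow> (('a \<Rightarrow> 'a) \<Rightarrow> complex) \<Rightarrow> bool" where
  "tracial_state M \<tau> \<longleftrightarrow>
     (\<forall>f\<in>M. \<forall>g\<in>M. \<tau> (\<lambda>x. f x + g x) = \<tau> f + \<tau> g) \<and>
     (\<forall>c. \<forall>f\<in>M. \<tau> (\<lambda>x. c *\<^sub>C f x) = c * \<tau> f) \<and>
     (\<forall>f\<in>M. positive_op f \<longrightarrow> \<tau> f \<in> \<real>\<^sub>\<ge>\<^sub>0) \<and>
     \<tau> id = 1 \<and>
     (\<forall>f\<in>M. \<forall>g\<in>M. \<tau> (f \<circ> g) = \<tau> (g \<circ> f))"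

definition faithful_on ::
  "('a::complex_hilbert_space \<Rightarrow> 'a) set \<Rightarrow> (('a \<Rightarrow> 'a) \<Rightarrow> complex) \<Rightarrow> bool" where
  "faithful_on M \<tau> \<longleftrightarrow> (\<forall>f\<in>M. positive_op f \<and> \<tau> f = 0 \<longrightarrow> f = (\<lambda>x. 0))"

text \<open>Normality: \<open>\<tau>\<close> preserves suprema of bounded increasing nets of positive elements. A net is
  represented by its range, an upward directed set \<open>D\<close>, whose supremum in the self-adjoint part
  of \<open>M\<close> is \<open>s\<close>.\<close>

definition normal_on ::
  "('a::complex_hilbert_space \<Rightarrow> 'a) set \<Rightarrow> (('a \<Rightarrow> 'a) \<Rightarrow> complex) \<Rightarrow> bool" where
  "normal_on M \<tau> \<longleftrightarrow>
     (\<forall>D s. D \<subseteq> M \<and> D \<noteq> {} \<and> (\<forall>f\<in>D. positive_op f) \<and>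
        (\<forall>f\<in>D. \<forall>g\<in>D. \<exists>h\<in>D. op_le f h \<and> op_le g h) \<and>
        s \<in> M \<and> (\<forall>f\<in>D. op_le f s) \<and>
        (\<forall>t\<in>M. is_adjoint t t \<and> (\<forall>f\<in>D. op_le f t) \<longrightarrow> op_le s t)
        \<longrightarrow> Re (\<tau> s) = (SUP f\<in>D. Re (\<tau> f)))"

definition finite_von_neumann_algebra ::
  "('a::complex_hilbert_space \<Rightarrow> 'a) set \<Rightarrow> (('a \<Rightarrow> 'a) \<Rightarrow> complex) \<Rightarrow> bool" where
  "finite_von_neumann_algebra M \<tau> \<longleftrightarrow>
     von_neumann_algebra M \<and> tracial_state M \<tau> \<and> faithful_on M \<tau> \<and> normal_on M \<tau>"


section \<open>Unbounded operators\<close>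

text \<open>An unbounded operator is identified with its graph, so that its domain is \<^const>\<open>Domain\<close>, the
  closure of a closable operator is the topological closure of the graph, and composition is
  \<^const>\<open>relcomp\<close> with reversed arguments.\<close>

type_synonym 'a unbounded_op = "('a \<times> 'a) set"

definition linear_operator :: "'a::complex_hilbert_space unbounded_op \<Rightarrow> bool" where
  "linear_operator A \<longleftrightarrow>
     single_valued A \<and> (0, 0) \<in> A \<and>
     (\<forall>x y x' y'. (x, y) \<in> A \<and> (x', y') \<in> A \<longrightarrow> (x + x', y + y') \<in> A) \<and>
     (\<forall>c x y. (x, y) \<in> A \<longrightarrow> (c *\<^sub>C x, c *\<^sub>C y) \<in> A)"

definition closed_densely_defined :: "'a::complex_hilbert_space unbounded_op \<Rightarrow> bool" where
  "closed_densely_defined A \<longleftrightarrow>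
     linear_operator A \<and> closed A \<and> closure (Domain A) = UNIV"

definition op_graph :: "('a \<Rightarrow> 'a) \<Rightarrow> 'a unbounded_op" where
  "op_graph f = {(x, f x) | x. True}"

definition affiliated_operators ::
  "('a::complex_hilbert_space \<Rightarrow> 'a) set \<Rightarrow> 'a unbounded_op set"  (\<open>L\<^sup>0\<close>) where
  "L\<^sup>0 M = {A. closed_densely_defined A \<and>
     (\<forall>u\<in>commutant M. unitary_op u \<longrightarrow> A O op_graph u = op_graph u O A)}"

definition unbounded_adjoint ::
  "'a::complex_hilbert_space unbounded_op \<Rightarrow> 'a unbounded_op" where
  "unbounded_adjoint A = {(y, z). \<forall>(x, w)\<in>A. cinner w y = cinner x z}"

definition self_adjoint :: "'a::complex_hilbert_space unbounded_op \<Rightarrow> bool" where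
  "self_adjoint A \<longleftrightarrow>
     linear_operator A \<and> closure (Domain A) = UNIV \<and> unbounded_adjoint A = A"

definition strong_sum ::
  "'a::complex_hilbert_space unbounded_op \<Rightarrow> 'a unbounded_op \<Rightarrow> 'a unbounded_op" where
  "strong_sum A B = closure {(x, y + z) | x y z. (x, y) \<in> A \<and> (x, z) \<in> B}"

text \<open>The closure matters only for \<open>c = 0\<close>, where it yields the zero operator on the whole space.\<close>

definition strong_scale ::
  "complex \<Rightarrow> 'a::complex_hilbert_space unbounded_op \<Rightarrow> 'a unbounded_op" where
  "strong_scale c A = closure {(x, c *\<^sub>C y) | x y. (x, y) \<in> A}"

primrec hamiltonian ::
  "(nat \<Rightarrow> 'a::complex_hilbert_space unbounded_op) \<Rightarrow> (nat \<Rightarrow> real) \<Rightarrow> nat \<Rightarrow> 'a unbounded_op"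
where
  "hamiltonian V y 0 = V 0"
| "hamiltonian V y (Suc n) =
     strong_sum (hamiltonian V y n) (strong_scale (complex_of_real (y (Suc n))) (V (Suc n)))"


section \<open>Unitary groups\<close>

definition unitary_group :: "(real \<Rightarrow> 'a::complex_hilbert_space \<Rightarrow> 'a) \<Rightarrow> bool" where
  "unitary_group U \<longleftrightarrow>
     (\<forall>s. unitary_op (U s)) \<and> U 0 = id \<and> (\<forall>s t. U (s + t) = U s \<circ> U t) \<and>
     (\<forall>x. continuous_on UNIV (\<lambda>s. U s x))"

text \<open>\<open>U s = exp (- \<i> s A)\<close> for all \<open>s\<close>, in the sense of Stone's theorem: \<open>U\<close> is the strongly
  continuous one-parameter unitary group whose infinitesimal generator is \<open>- \<i> A\<close>. For
  self-adjoint \<open>A\<close> there is exactly one such \<open>U\<close>.\<close>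

definition generated_group ::
  "'a::complex_hilbert_space unbounded_op \<Rightarrow> (real \<Rightarrow> 'a \<Rightarrow> 'a) \<Rightarrow> bool" where
  "generated_group A U \<longleftrightarrow>
     unitary_group U \<and>
     A = {(x, y). ((\<lambda>s. (U s x - x) /\<^sub>R s) \<longlongrightarrow> - (\<i> *\<^sub>C y)) (at 0)}"

definition is_exp ::
  "'a::complex_hilbert_space unbounded_op \<Rightarrow> real \<Rightarrow> ('a \<Rightarrow> 'a) \<Rightarrow> bool" where
  "is_exp A s W \<longleftrightarrow> (\<exists>U. generated_group A U \<and> W = U s)"


section \<open>The control system\<close>

text \<open>Finitely many pieces on each bounded interval; the values at the break points are
  irrelevant.\<close>

definition piecewise_constant :: "(real \<Rightarrow> real) \<Rightarrow> bool" where
  "piecewise_constant f \<longleftrightarrow>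
     (\<forall>a b. \<exists>S. finite S \<and>
        (\<forall>s t. a \<le> s \<and> s < t \<and> t \<le> b \<and> {s..t} \<inter> S = {} \<longrightarrow> f s = f t))"

inductive propagator ::
  "real \<Rightarrow> (nat \<Rightarrow> 'a::complex_hilbert_space unbounded_op) \<Rightarrow> nat \<Rightarrow> (nat \<Rightarrow> real \<Rightarrow> real) \<Rightarrow>
   real \<Rightarrow> ('a \<Rightarrow> 'a) \<Rightarrow> bool"
  for hbar :: real and V :: "nat \<Rightarrow> 'a::complex_hilbert_space unbounded_op" and N :: nat
    and c :: "nat \<Rightarrow> real \<Rightarrow> real"
where
  start: "propagator hbar V N c 0 id"
| piece: "propagator hbar V N c t' (W \<circ> P)"
  if "propagator hbar V N c t P" and "t < t'"
    and "\<forall>r\<in>{t<..<t'}. \<forall>j\<in>{1..N}. c j r = y j"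
    and "is_exp (hamiltonian V y N) ((t' - t) / hbar) W"

definition solution ::
  "real \<Rightarrow> (nat \<Rightarrow> 'a::complex_hilbert_space unbounded_op) \<Rightarrow> nat \<Rightarrow> (nat \<Rightarrow> real \<Rightarrow> real) \<Rightarrow>
   'a \<Rightarrow> (real \<Rightarrow> 'a) \<Rightarrow> bool" where
  "solution hbar V N c \<xi>\<^sub>0 \<xi> \<longleftrightarrow>
     (\<forall>t\<ge>0. \<exists>P. propagator hbar V N c t P \<and> \<xi> t = P \<xi>\<^sub>0)"

definition pure_state_controllable ::
  "real \<Rightarrow> (nat \<Rightarrow> 'a::complex_hilbert_space unbounded_op) \<Rightarrow> nat \<Rightarrow> bool" where
  "pure_state_controllable hbar V N \<longleftrightarrow>
     (\<forall>\<xi>\<^sub>0 \<xi>\<^sub>f. norm \<xi>\<^sub>0 = 1 \<and> norm \<xi>\<^sub>f = 1 \<longrightarrow>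
        (\<exists>c T \<xi>. (\<forall>j\<in>{1..N}. piecewise_constant (c j)) \<and> T > 0 \<and>
           solution hbar V N c \<xi>\<^sub>0 \<xi> \<and> \<xi> T = \<xi>\<^sub>f))"

end

theory Submission
  imports Defs
begin

text \<open>A non-scalar central element yields a non-scalar self-adjoint \<open>z\<close> of small norm in \<open>M \<inter> M'\<close>,
  whose Cayley transform \<open>u = (1 - \<i> z) (1 + \<i> z)\<^sup>-\<^sup>1\<close> is a non-scalar unitary in \<open>M'\<close>. The graphs of
  all \<open>V\<^sub>j\<close>, hence of all Hamiltonians, are invariant under \<open>u \<times> u\<close>, so \<open>u\<close> commutes with the unitary
  groups that they generate (uniqueness in Stone's theorem) and \<open>\<langle>\<xi>, u \<xi>\<rangle>\<close> is conserved along
  every solution. If all unit vectors could be reached from one of them, this quantity would be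
  constant on the unit sphere, and \<open>u\<close> would be scalar by polarization.\<close>

section \<open>Complex Hilbert spaces\<close>

lemma scaleC_one [simp]: "1 *\<^sub>C x = (x::'a::complex_hilbert_space)"
  using scaleR_scaleC[of 1 x] by simp

lemma scaleC_zero_left [simp]: "0 *\<^sub>C x = (0::'a::complex_hilbert_space)"
  using scaleR_scaleC[of 0 x] by simp

lemma scaleC_zero_right [simp]: "c *\<^sub>C 0 = (0::'a::complex_hilbert_space)"
  using scaleC_add_right[of c 0 "0::'a"] by simp

lemma scaleC_minus_right: "c *\<^sub>C (- x) = - (c *\<^sub>C (x::'a::complex_hilbert_space))"
  using scaleC_add_right[of c x "- x"] by (simp add: eq_neg_iff_add_eq_0 add.commute)

lemma scaleC_minus_left: "(- c) *\<^sub>C x = - (c *\<^sub>C (x::'a::complex_hilbert_space))"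
  using scaleC_add_left[of c "- c" x] by (simp add: eq_neg_iff_add_eq_0 add.commute)

lemma scaleC_diff_right: "c *\<^sub>C (x - y) = c *\<^sub>C x - c *\<^sub>C (y::'a::complex_hilbert_space)"
  using scaleC_add_right[of c x "- y"] by (simp add: scaleC_minus_right)

lemma scaleC_scaleR: "c *\<^sub>C r *\<^sub>R x = r *\<^sub>R c *\<^sub>C (x::'a::complex_hilbert_space)"
  by (simp add: scaleR_scaleC scaleC_scaleC mult.commute)

lemma cinner_add_left: "cinner (x + y) z = cinner x z + cinner (y::'a::complex_hilbert_space) z"
  by (metis cinner_add_right cinner_commute complex_cnj_add)

lemma cinner_scaleC_left: "cinner (c *\<^sub>C x) y = cnj c * cinner x (y::'a::complex_hilbert_space)"
  by (metis cinner_scaleC_right cinner_commute complex_cnj_mult)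

lemma cinner_zero_right [simp]: "cinner x (0::'a::complex_hilbert_space) = 0"
  using cinner_add_right[of x 0 0] by simp

lemma cinner_zero_left [simp]: "cinner (0::'a::complex_hilbert_space) x = 0"
  using cinner_add_left[of 0 0 x] by simp

lemma cinner_minus_right: "cinner x (- y) = - cinner x (y::'a::complex_hilbert_space)"
  using cinner_add_right[of x y "- y"] by (simp add: eq_neg_iff_add_eq_0 add.commute)

lemma cinner_minus_left: "cinner (- x) y = - cinner x (y::'a::complex_hilbert_space)"
  using cinner_add_left[of x "- x" y] by (simp add: eq_neg_iff_add_eq_0 add.commute)

lemma cinner_diff_right: "cinner x (y - z) = cinner x y - cinner x (z::'a::complex_hilbert_space)"
  using cinner_add_right[of x y "- z"] by (simp add: cinner_minus_right)

lemma cinner_diff_left: "cinner (x - y) z = cinner x z - cinner (y::'a::complex_hilbert_space) z"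
  using cinner_add_left[of x "- y" z] by (simp add: cinner_minus_left)

lemmas cinner_simps = cinner_add_left cinner_add_right cinner_diff_left cinner_diff_right
  cinner_minus_left cinner_minus_right cinner_scaleC_left cinner_scaleC_right

lemma cinner_self: "cinner x x = complex_of_real ((norm (x::'a::complex_hilbert_space))\<^sup>2)"
proof -
  have "Im (cinner x x) = 0"
    using cinner_commute[of x x] by (metis complex_cnj complex.sel(2) complex_surj neg_equal_zero)
  moreover have "sqrt (Re (cinner x x)) \<ge> 0"
    using norm_ge_zero[of x] by (simp only: norm_eq_sqrt_cinner)
  then have "Re (cinner x x) = (norm x)\<^sup>2"
    by (simp add: norm_eq_sqrt_cinner)
  ultimately show ?thesis
    by (simp add: complex_eq_iff)
qed

lemma Re_cinner_commute: "Re (cinner x y) = Re (cinner y (x::'a::complex_hilbert_space))"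
  by (subst cinner_commute) simp

lemma power2_norm_add:
  "(norm (x + y))\<^sup>2 = (norm x)\<^sup>2 + 2 * Re (cinner x y) + (norm (y::'a::complex_hilbert_space))\<^sup>2"
proof -
  have "complex_of_real ((norm (x + y))\<^sup>2) = cinner x x + cinner x y + cinner y x + cinner y y"
    by (simp only: cinner_simps cinner_self[symmetric] add_ac)
  then have "Re (complex_of_real ((norm (x + y))\<^sup>2)) =
      Re (cinner x x) + Re (cinner x y) + Re (cinner y x) + Re (cinner y y)"
    by simp
  then show ?thesis
    by (simp add: Re_cinner_commute[of y x] cinner_self)
qed

text \<open>Cauchy-Schwarz runs backwards here: the triangle inequality is a class axiom, and
  squaring it leaves exactly this bound on the cross term.\<close>

lemma Re_cinner_le: "Re (cinner x y) \<le> norm x * norm (y::'a::complex_hilbert_space)"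
proof -
  have "(norm (x + y))\<^sup>2 \<le> (norm x + norm y)\<^sup>2"
    by (intro power_mono norm_triangle_ineq norm_ge_zero)
  then show ?thesis
    by (simp add: power2_norm_add) (simp add: power2_eq_square algebra_simps)
qed

text \<open>The real part is a real inner product; as a bounded bilinear map it admits the product
  rule for derivatives, which is how squared norms along orbits get differentiated.\<close>

lemma bounded_bilinear_Re_cinner:
  "bounded_bilinear (\<lambda>x y::'a::complex_hilbert_space. Re (cinner x y))"
proof
  show "\<exists>K. \<forall>a b::'a. norm (Re (cinner a b)) \<le> norm a * norm b * K"
  proof (intro exI allI)
    fix a b :: 'a
    show "norm (Re (cinner a b)) \<le> norm a * norm b * 1"
      using Re_cinner_le[of a b] Re_cinner_le[of a "- b"] by (simp add: cinner_simps abs_le_iff)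
  qed
qed (simp_all add: cinner_simps scaleR_scaleC)

lemma norm_scaleC: "norm (c *\<^sub>C x) = cmod c * norm (x::'a::complex_hilbert_space)"
proof -
  have "complex_of_real ((norm (c *\<^sub>C x))\<^sup>2) = complex_of_real ((cmod c * norm x)\<^sup>2)"
    by (simp only: cinner_simps power_mult_distrib of_real_mult complex_norm_square
        cinner_self[symmetric] mult_ac)
  then have "(norm (c *\<^sub>C x))\<^sup>2 = (cmod c * norm x)\<^sup>2"
    by (simp only: of_real_eq_iff)
  then show ?thesis
    by simp
qed

lemma bounded_linear_scaleC: "bounded_linear (\<lambda>x::'a::complex_hilbert_space. c *\<^sub>C x)"
  by (rule bounded_linear_intro[where K = "cmod c"])
    (simp_all add: scaleC_add_right scaleC_scaleR norm_scaleC mult.commute)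

text \<open>Polarization over the complex numbers: testing the pair \<open>T x\<close>,
  \<open>x\<close> and the pair \<open>T x\<close>, \<open>\<i> *\<^sub>C x\<close> gives <Tx,Tx> +
  <x,TTx> = 0 and <Tx,Tx> - <x,TTx> = 0. A real rotation by a right angle shows that the imaginary
  unit is essential.\<close>

lemma quadratic_form_eq_zero:
  fixes T :: "'a::complex_hilbert_space \<Rightarrow> 'a"
  assumes add: "\<And>x y. T (x + y) = T x + T y" and scale: "\<And>c x. T (c *\<^sub>C x) = c *\<^sub>C T x"
    and zero: "\<And>x. cinner x (T x) = 0"
  shows "T x = 0"
proof -
  have *: "cinner v (T w) + cinner w (T v) = 0" for v w
    using zero[of "v + w"] by (simp add: add cinner_simps zero add.commute)
  have "cinner (T x) (T x) = 0"
    using *[of "T x" x] *[of "T x" "\<i> *\<^sub>C x"] by (simp add: scale cinner_simps)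
  then show ?thesis
    by (simp add: cinner_self)
qed


section \<open>Bounded operators and commutants\<close>

lemma bounded_clinear_scaleC: "bounded_clinear (\<lambda>x::'a::complex_hilbert_space. c *\<^sub>C x)"
  by (simp add: bounded_clinear_def bounded_linear_scaleC scaleC_scaleC mult.commute)

lemma bounded_clinear_add:
  "bounded_clinear f \<Longrightarrow> bounded_clinear g \<Longrightarrow> bounded_clinear (\<lambda>x. f x + g x)"
  by (simp add: bounded_clinear_def bounded_linear_add scaleC_add_right)

lemma bounded_clinear_compose:
  "bounded_clinear f \<Longrightarrow> bounded_clinear g \<Longrightarrow> bounded_clinear (\<lambda>x. f (g x))"
  by (simp add: bounded_clinear_def bounded_linear_compose)

lemma bounded_clinearD:
  assumes "bounded_clinear f"
  shows "f (x + y) = f x + f y" "f (c *\<^sub>C x) = c *\<^sub>C f x" "f (x - y) = f x - f y" "f 0 = 0"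
    "f (r *\<^sub>R x) = r *\<^sub>R f x"
  using assms
  by (auto simp: bounded_clinear_def linear_add linear_diff linear_0 linear_scale
      dest!: bounded_linear.linear)

lemma unitary_opD:
  assumes "unitary_op u"
  shows "bounded_clinear u" "bounded_linear u" "surj u" "cinner (u x) (u y) = cinner x y"
    "norm (u x) = norm x"
  using assms by (auto simp: unitary_op_def bounded_clinear_def norm_eq_sqrt_cinner)

lemma is_adjoint_sym: "is_adjoint f g \<Longrightarrow> is_adjoint g f"
  unfolding is_adjoint_def by (metis cinner_commute)

lemma is_adjoint_unique:
  assumes "is_adjoint f g" "is_adjoint f h"
  shows "g = h"
proof
  fix y
  have "cinner (g y - h y) (g y - h y) = 0"
    using assms by (simp add: is_adjoint_def cinner_diff_right)
  then show "g y = h y"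
    by (simp add: cinner_self)
qed

lemma commutant_add: "f \<in> commutant M \<Longrightarrow> g \<in> commutant M \<Longrightarrow> M \<subseteq> {f. bounded_clinear f} \<Longrightarrow>
    (\<lambda>x. f x + g x) \<in> commutant M"
  by (auto simp: commutant_def bounded_clinear_add fun_eq_iff bounded_clinearD subset_iff)

lemma commutant_scaleC: "f \<in> commutant M \<Longrightarrow> M \<subseteq> {f. bounded_clinear f} \<Longrightarrow>
    (\<lambda>x. c *\<^sub>C f x) \<in> commutant M"
  by (auto simp: commutant_def bounded_clinear_compose bounded_clinear_scaleC fun_eq_iff
      bounded_clinearD subset_iff)

lemma scaleC_in_commutant: "M \<subseteq> {f. bounded_clinear f} \<Longrightarrow> (\<lambda>x. c *\<^sub>C x) \<in> commutant M"
  by (auto simp: commutant_def bounded_clinear_scaleC fun_eq_iff bounded_clinearD subset_iff)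

text \<open>With \<open>g\<close> the adjoint of \<open>f\<close>, both \<open>w \<circ> f\<close>
  and \<open>f \<circ> w\<close> are adjoints of the one operator
  \<open>g \<circ> z = z \<circ> g\<close>, and adjoints are unique.\<close>

lemma commutant_adjoint:
  assumes M: "\<And>f. f \<in> M \<Longrightarrow> \<exists>g\<in>M. is_adjoint f g"
    and z: "z \<in> commutant M" and adj: "is_adjoint z w" and w: "bounded_clinear w"
  shows "w \<in> commutant M"
proof -
  have "f \<circ> w = w \<circ> f" if f: "f \<in> M" for f
  proof -
    obtain g where g: "g \<in> M" "is_adjoint f g"
      using M[OF f] by blast
    have gz: "g (z x) = z (g x)" for x
      using z g(1) by (auto simp: commutant_def fun_eq_iff)
    have gf: "cinner (g x) y = cinner x (f y)" for x y
      using is_adjoint_sym[OF g(2)] by (auto simp: is_adjoint_def)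
    have zw: "cinner (z x) y = cinner x (w y)" for x y
      using adj by (auto simp: is_adjoint_def)
    have "is_adjoint (\<lambda>x. g (z x)) (w \<circ> f)"
      by (simp add: is_adjoint_def gf zw)
    moreover have "is_adjoint (\<lambda>x. g (z x)) (f \<circ> w)"
      by (simp add: is_adjoint_def gz zw gf)
    ultimately show ?thesis
      using is_adjoint_unique by blast
  qed
  then show ?thesis
    using w by (simp add: commutant_def)
qed

text \<open>A non-scalar central element is a combination of its real and imaginary parts, so at
  least one of these is non-scalar.\<close>

lemma nonscalar_self_adjoint_in_commutant:
  fixes M :: "('a::complex_hilbert_space \<Rightarrow> 'a) set"
  assumes "von_neumann_algebra M" "\<not> factor M"
  obtains z where "z \<in> commutant M" "is_adjoint z z" "\<nexists>c. z = (\<lambda>x. c *\<^sub>C x)"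
proof -
  have bd: "M \<subseteq> {f. bounded_clinear f}" and adjM: "\<And>f. f \<in> M \<Longrightarrow> \<exists>g\<in>M. is_adjoint f g"
    and bi: "commutant (commutant M) = M"
    using assms(1) by (auto simp: von_neumann_algebra_def)
  have "commutant M \<subseteq> {f. bounded_clinear f}"
    by (auto simp: commutant_def)
  \<comment> \<open>The bicommutant condition puts the scalars into \<open>M\<close> itself, so
    failing to be a factor can only mean that the centre has a further element
    \<open>w\<close>.\<close>
  then have "(\<lambda>x. c *\<^sub>C x) \<in> M \<inter> commutant M" for c
    using scaleC_in_commutant[of M c] scaleC_in_commutant[of "commutant M" c] bd bi by auto
  then obtain w where w: "w \<in> M" "w \<in> commutant M" "\<nexists>c. w = (\<lambda>x. c *\<^sub>C x)"
    using assms(2) unfolding factor_def by blast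
  obtain v where v: "v \<in> M" "is_adjoint w v"
    using adjM w(1) by blast
  have vM: "v \<in> commutant M"
    using commutant_adjoint[OF adjM w(2) v(2)] v(1) bd by auto
  have wv: "cinner (w x) y = cinner x (v y)" and vw: "cinner (v x) y = cinner x (w y)" for x y
    using v(2) is_adjoint_sym[OF v(2)] by (auto simp: is_adjoint_def)
  \<comment> \<open>Since \<open>v\<close> is the adjoint of \<open>w\<close>, \<open>a\<close> is
    twice the real part of \<open>w\<close>, and \<open>b\<close> is minus twice its imaginary part;
    hence w = a/2 + b/(2i).\<close>
  define a where "a x = w x + v x" for x
  define b where "b x = \<i> *\<^sub>C w x + (- \<i>) *\<^sub>C v x" for x
  have a: "a \<in> commutant M" "is_adjoint a a"
    using commutant_add[OF w(2) vM bd]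
    by (simp_all add: a_def[abs_def] is_adjoint_def cinner_simps wv vw)
  have b: "b \<in> commutant M" "is_adjoint b b"
    using commutant_add[OF commutant_scaleC[OF w(2) bd] commutant_scaleC[OF vM bd] bd, of "\<i>" "- \<i>"]
    by (simp_all add: b_def[abs_def] is_adjoint_def cinner_simps wv vw)
  have "\<not> ((\<exists>c. a = (\<lambda>x. c *\<^sub>C x)) \<and> (\<exists>d. b = (\<lambda>x. d *\<^sub>C x)))"
  proof
    assume "(\<exists>c. a = (\<lambda>x. c *\<^sub>C x)) \<and> (\<exists>d. b = (\<lambda>x. d *\<^sub>C x))"
    then obtain c d where cd: "\<And>x. a x = c *\<^sub>C x" "\<And>x. b x = d *\<^sub>C x"
      by auto
    have "w x = (c / 2 + d / (2 * \<i>)) *\<^sub>C x" for x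
    proof -
      have "(c / 2 + d / (2 * \<i>)) *\<^sub>C x = (1 / 2) *\<^sub>C a x + (1 / (2 * \<i>)) *\<^sub>C b x"
        unfolding cd scaleC_scaleC scaleC_add_left[symmetric] by simp
      also have "\<dots> = (1/2) *\<^sub>C w x + (1/2) *\<^sub>C w x"
        by (simp add: a_def b_def scaleC_add_right scaleC_scaleC scaleC_minus_left scaleC_minus_right
            scaleC_diff_right)
      also have "\<dots> = w x"
        by (simp flip: scaleC_add_left)
      finally show ?thesis
        by simp
    qed
    with w(3) show False
      by blast
  qed
  then show thesis
    using that a b by blast
qed


section \<open>The Cayley transform\<close>

text \<open>A solution of x + f x = y is a fixed point of the contraction x \<mapsto> y - f
  x.\<close>

lemma surj_id_plus_contraction:
  fixes f :: "'a::banach \<Rightarrow> 'a"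
  assumes "linear f" "\<And>x. norm (f x) \<le> k * norm x" "0 \<le> k" "k < 1"
  shows "\<exists>x. x + f x = y"
proof -
  have "\<exists>!x. y - f x = x"
  proof (rule banach_fix_type[OF assms(3,4)], intro allI)
    fix v w
    show "dist (y - f v) (y - f w) \<le> k * dist v w"
      using assms(2)[of "w - v"] by (simp add: dist_norm linear_diff[OF assms(1)] norm_minus_commute)
  qed
  then show ?thesis
    by (metis diff_add_cancel)
qed

text \<open>The bound \<open>k < 1\<close> makes 1 + iz and 1 - iz surjective without spectral
  theory; symmetry of \<open>z\<close> makes 1 + iz bounded below, hence invertible. The Cayley
  transform can be solved for \<open>z\<close>, so it is scalar only if \<open>z\<close> is.\<close>

lemma nonscalar_unitary_in_commutant:
  fixes z :: "'a::complex_hilbert_space \<Rightarrow> 'a"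
  assumes M: "M \<subseteq> {f. bounded_clinear f}"
    and z: "z \<in> commutant M" "is_adjoint z z" "\<nexists>c. z = (\<lambda>x. c *\<^sub>C x)"
    and contr: "\<And>x. norm (z x) \<le> k * norm x" "0 \<le> k" "k < 1"
  obtains u where "u \<in> commutant M" "unitary_op u" "\<nexists>c. u = (\<lambda>x. c *\<^sub>C x)"
proof -
  have zl: "bounded_clinear z"
    using z(1) by (simp add: commutant_def)
  have zsym: "cinner (z x) y = cinner x (z y)" for x y
    using z(2) by (simp add: is_adjoint_def)
  have lin: "linear (\<lambda>x. c *\<^sub>C z x)" for c
    using bounded_clinear_compose[OF bounded_clinear_scaleC zl]
    by (auto simp: bounded_clinear_def bounded_linear.linear)
  have nz: "norm (c *\<^sub>C z x) \<le> k * norm x" if "cmod c = 1" for c x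
    using contr(1)[of x] that by (simp add: norm_scaleC)
  define p where "p x = x + \<i> *\<^sub>C z x" for x
  define m where "m x = x + (- \<i>) *\<^sub>C z x" for x
  have psurj: "\<exists>x. p x = y" and msurj: "\<exists>x. m x = y" for y
    unfolding p_def m_def by (intro surj_id_plus_contraction[OF lin nz contr(2,3)]; simp)+
  have bcl: "bounded_clinear (\<lambda>x. x + c *\<^sub>C z x)" for c
    using bounded_clinear_add[OF bounded_clinear_scaleC[of 1]
        bounded_clinear_compose[OF bounded_clinear_scaleC zl]] by simp
  have pl: "bounded_clinear p" and ml: "bounded_clinear m"
    using bcl by (simp_all add: p_def[abs_def] m_def[abs_def])
  \<comment> \<open>The cross terms cancel by symmetry of \<open>z\<close>. The two right-hand sides
    agree, which makes \<open>m\<close> after the inverse of \<open>p\<close> isometric.\<close>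
  have pp: "cinner (p x) (p y) = cinner x y + cinner (z x) (z y)"
    and mm: "cinner (m x) (m y) = cinner x y + cinner (z x) (z y)" for x y
    by (simp_all add: p_def m_def cinner_simps zsym algebra_simps)
  have pnorm: "norm x \<le> norm (p x)" for x
  proof -
    have "complex_of_real ((norm (p x))\<^sup>2) = complex_of_real ((norm x)\<^sup>2 + (norm (z x))\<^sup>2)"
      using pp[of x x] by (simp add: cinner_self)
    then have "(norm x)\<^sup>2 \<le> (norm (p x))\<^sup>2"
      by (simp only: of_real_eq_iff) simp
    then show ?thesis
      by (simp add: power2_le_iff_abs_le)
  qed
  have inj: "x = y" if "p x = p y" for x y
    using pnorm[of "x - y"] that by (simp add: bounded_clinearD[OF pl])
  define r where "r = inv p"
  have pr: "p (r y) = y" for y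
    using psurj[of y] unfolding r_def by (metis surj_f_inv_f surj_def psurj)
  have rp: "r (p y) = y" for y
    using inj pr by blast
  have rlin: "bounded_clinear r"
  proof -
    have "r (x + y) = r x + r y" "r (s *\<^sub>R x) = s *\<^sub>R r x" "r (c *\<^sub>C x) = c *\<^sub>C r x" for x y s c
      by (rule inj, simp add: pr bounded_clinearD[OF pl])+
    moreover have "norm (r x) \<le> norm x * 1" for x
      using pnorm[of "r x"] by (simp add: pr)
    ultimately show ?thesis
      unfolding bounded_clinear_def by (blast intro: bounded_linear_intro)
  qed
  define u where "u x = m (r x)" for x
  have ubl: "bounded_clinear u"
    unfolding u_def[abs_def] by (rule bounded_clinear_compose[OF ml rlin])
  have unit: "unitary_op u"
    unfolding unitary_op_def
  proof (intro conjI allI ubl)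
    show "surj u"
      unfolding surj_def u_def by (metis rp msurj)
    show "cinner (u x) (u y) = cinner x y" for x y
      unfolding u_def mm pp[symmetric] pr ..
  qed
  have uM: "u \<in> commutant M"
  proof -
    have "f (u x) = u (f x)" if "f \<in> M" for f x
    proof -
      have f: "bounded_clinear f" and fz: "f (z x) = z (f x)" for x
        using that M z(1) by (auto simp: commutant_def fun_eq_iff)
      have fp: "f (p x) = p (f x)" and fm: "f (m x) = m (f x)" for x
        by (simp_all add: p_def m_def bounded_clinearD[OF f] fz)
      have "f (r x) = r (f x)"
        by (rule inj) (simp add: pr flip: fp)
      then show ?thesis
        by (simp add: u_def fm)
    qed
    then show ?thesis
      using ubl by (simp add: commutant_def fun_eq_iff)
  qed
  have "\<nexists>c. u = (\<lambda>x. c *\<^sub>C x)"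
  proof
    assume "\<exists>c. u = (\<lambda>x. c *\<^sub>C x)"
    then obtain c where "\<And>x. u x = c *\<^sub>C x"
      by auto
    then have "m x = c *\<^sub>C p x" for x
      using rp by (metis u_def)
    then have *: "x + (- \<i>) *\<^sub>C z x = c *\<^sub>C x + (c * \<i>) *\<^sub>C z x" for x
      by (simp add: p_def m_def scaleC_add_right scaleC_scaleC)
    \<comment> \<open>The relation m = c p solved for \<open>z\<close>; only \<open>c = -1\<close>
      forbids the division.\<close>
    have **: "(1 - c) *\<^sub>C x = (\<i> * (1 + c)) *\<^sub>C z x" for x
    proof -
      have "(1 - c) *\<^sub>C x = x + (- 1 * c) *\<^sub>C x"
        using scaleC_add_left[of 1 "- c" x] by simp
      also have "\<dots> = (x + (- \<i>) *\<^sub>C z x) - c *\<^sub>C x + \<i> *\<^sub>C z x"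
        by (simp add: scaleC_minus_left)
      also have "\<dots> = (c * \<i>) *\<^sub>C z x + \<i> *\<^sub>C z x"
        unfolding * by simp
      finally show ?thesis
        by (simp add: algebra_simps flip: scaleC_add_left)
    qed
    show False
    proof (cases "c = -1")
      \<comment> \<open>Now 2x = 0 for every \<open>x\<close>: the space is trivial, and
        \<open>z\<close> is the scalar 0 after all.\<close>
      case True
      then have "(x::'a) = 0" for x
        using **[of x] norm_scaleC[of 2 x] by simp
      then have "z = (\<lambda>x. 0 *\<^sub>C x)"
        by (metis)
      then show False
        using z(3) by blast
    next
      case False
      then have nz: "\<i> * (1 + c) \<noteq> 0"
        by (simp add: add_eq_0_iff)
      have "z x = ((1 - c) / (\<i> * (1 + c))) *\<^sub>C x" for x
      proof -
        have "z x = (1 / (\<i> * (1 + c))) *\<^sub>C (\<i> * (1 + c)) *\<^sub>C z x"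
          using nz by (simp only: scaleC_scaleC) simp
        also have "\<dots> = ((1 - c) / (\<i> * (1 + c))) *\<^sub>C x"
          unfolding **[symmetric] by (simp only: scaleC_scaleC) simp
        finally show ?thesis .
      qed
      then show False
        using z(3) by blast
    qed
  qed
  then show thesis
    using that uM unit by blast
qed

text \<open>Dividing the self-adjoint element by twice a bound of its norm provides the contraction
  constant 1/2 and keeps it self-adjoint and non-scalar.\<close>

lemma not_factor_nonscalar_unitary:
  fixes M :: "('a::complex_hilbert_space \<Rightarrow> 'a) set"
  assumes vN: "von_neumann_algebra M" and "\<not> factor M"
  obtains u where "u \<in> commutant M" "unitary_op u" "\<nexists>c. u = (\<lambda>x. c *\<^sub>C x)"
proof -
  have bd: "M \<subseteq> {f. bounded_clinear f}"
    using vN by (auto simp: von_neumann_algebra_def)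
  obtain z where z: "z \<in> commutant M" "is_adjoint z z" "\<nexists>c. z = (\<lambda>x. c *\<^sub>C x)"
    using nonscalar_self_adjoint_in_commutant[OF assms] by blast
  have "bounded_linear z"
    using z(1) by (simp add: commutant_def bounded_clinear_def)
  then obtain K where K: "K > 0" "\<And>x. norm (z x) \<le> norm x * K"
    using bounded_linear.pos_bounded by blast
  define s where "s = 1 / (2 * K)"
  have s: "s > 0"
    using K by (simp add: s_def)
  define w where "w x = complex_of_real s *\<^sub>C z x" for x
  have "w \<in> commutant M"
    unfolding w_def[abs_def] by (rule commutant_scaleC[OF z(1) bd])
  moreover have "is_adjoint w w"
    using z(2) by (simp add: w_def is_adjoint_def cinner_simps)
  moreover have "\<nexists>c. w = (\<lambda>x. c *\<^sub>C x)"
  proof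
    assume "\<exists>c. w = (\<lambda>x. c *\<^sub>C x)"
    then obtain c where c: "\<And>x. w x = c *\<^sub>C x"
      by auto
    have "z x = (c / complex_of_real s) *\<^sub>C x" for x
    proof -
      have "z x = (1 / complex_of_real s) *\<^sub>C w x"
        using s by (simp add: w_def scaleC_scaleC)
      then show ?thesis
        by (simp add: c scaleC_scaleC)
    qed
    then show False
      using z(3) by blast
  qed
  moreover have "norm (w x) \<le> 1 / 2 * norm x" for x
  proof -
    have "norm (w x) = s * norm (z x)"
      using s by (simp add: w_def norm_scaleC)
    also have "\<dots> \<le> s * (norm x * K)"
      using K(2)[of x] s by (intro mult_left_mono) auto
    also have "\<dots> = 1 / 2 * norm x"
      using K(1) by (simp add: s_def)
    finally show ?thesis .
  qed
  ultimately show thesis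
    using nonscalar_unitary_in_commutant[OF bd, of w "1/2"] that by auto
qed


section \<open>Unitary groups and their generators\<close>

text \<open>This links the difference quotients that define the generator with the derivative
  calculus, and lets the group law move derivatives from 0 to any time.\<close>

lemma has_vector_derivative_at_iff_tendsto:
  fixes f :: "real \<Rightarrow> 'a::real_normed_vector"
  shows "(f has_vector_derivative d) (at t) \<longleftrightarrow> ((\<lambda>h. (f (t + h) - f t) /\<^sub>R h) \<longlongrightarrow> d) (at 0)"
proof -
  have "norm (f (t + h) - f t - h *\<^sub>R d) / norm h = norm ((f (t + h) - f t) /\<^sub>R h - d)"
    if "h \<noteq> 0" for h
  proof -
    have "(f (t + h) - f t) /\<^sub>R h - d = (f (t + h) - f t - h *\<^sub>R d) /\<^sub>R h"
      using that by (simp add: scaleR_diff_right)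
    then show ?thesis
      by (simp add: divide_inverse mult.commute)
  qed
  then have "(\<lambda>h. norm (f (t + h) - f t - h *\<^sub>R d) / norm h) \<midarrow>0\<rightarrow> 0 \<longleftrightarrow>
      (\<lambda>h. norm ((f (t + h) - f t) /\<^sub>R h - d)) \<midarrow>0\<rightarrow> 0"
    by (intro Lim_cong_within) auto
  then show ?thesis
    by (simp add: has_vector_derivative_def has_derivative_at bounded_linear_scaleR_left
        tendsto_norm_zero_iff LIM_zero_iff)
qed

lemma generated_group_iff:
  assumes "generated_group A U"
  shows "(x, y) \<in> A \<longleftrightarrow> ((\<lambda>s. U s x) has_vector_derivative - (\<i> *\<^sub>C y)) (at 0)"
proof -
  have "U 0 = id" and A: "A = {(x, y). ((\<lambda>s. (U s x - x) /\<^sub>R s) \<longlongrightarrow> - (\<i> *\<^sub>C y)) (at 0)}"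
    using assms by (auto simp: generated_group_def unitary_group_def)
  then show ?thesis
    by (subst A) (simp add: has_vector_derivative_at_iff_tendsto)
qed

text \<open>Read off from the difference rule for derivatives and linearity of each
  \<open>U s\<close>.\<close>

lemma generated_group_diff:
  assumes U: "generated_group A U" and "(x, y) \<in> A" "(x', y') \<in> A"
  shows "(x - x', y - y') \<in> A"
proof -
  have "bounded_clinear (U s)" for s
    using U by (auto simp: generated_group_def unitary_group_def unitary_opD)
  then show ?thesis
    using has_vector_derivative_diff[OF assms(2,3)[unfolded generated_group_iff[OF U]]]
    by (simp add: generated_group_iff[OF U] bounded_clinearD scaleC_diff_right)
qed

text \<open>\<open>U t\<close> commutes with every \<open>U s\<close> and is bounded, so it may be
  applied to the derivative at 0.\<close>

lemma generated_group_invariant: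
  assumes U: "generated_group A U" and xy: "(x, y) \<in> A"
  shows "(U t x, U t y) \<in> A"
proof -
  have add: "U (s + t) = U s \<circ> U t" and un: "unitary_op (U s)" for s t
    using U by (auto simp: generated_group_def unitary_group_def)
  have eq: "U s (U t v) = U t (U s v)" for s v
    using add[of s t] add[of t s] by (simp add: fun_eq_iff add.commute)
  have "U t (- (\<i> *\<^sub>C y)) = - (\<i> *\<^sub>C U t y)"
    using bounded_clinearD(2)[OF unitary_opD(1)[OF un[of t]], of "- \<i>" y]
    by (simp add: scaleC_minus_left)
  then show ?thesis
    using bounded_linear.has_vector_derivative[OF unitary_opD(2)[OF un[of t]]
        xy[unfolded generated_group_iff[OF U]]]
    by (simp add: generated_group_iff[OF U] eq)
qed

lemma generated_group_has_vector_derivative: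
  assumes U: "generated_group A U" and xy: "(x, y) \<in> A"
  shows "((\<lambda>s. U s x) has_vector_derivative - (\<i> *\<^sub>C U t y)) (at t)"
proof -
  have "U (t + h) x = U h (U t x)" and "U 0 = id" for h
    using U by (auto simp: generated_group_def unitary_group_def add.commute[of t])
  then show ?thesis
    using generated_group_invariant[OF assms, of t, unfolded generated_group_iff[OF U]]
    by (simp add: has_vector_derivative_at_iff_tendsto)
qed

text \<open>The derivative at 0 of the constant squared norm of \<open>U s x\<close>. It says that
  <x, y> is real, which is symmetry of the generator in quadratic form.\<close>

lemma generated_group_symmetric:
  assumes U: "generated_group A U" and xy: "(x, y) \<in> A"
  shows "Re (cinner x (\<i> *\<^sub>C y)) = 0"
proof -
  have un: "unitary_op (U s)" and U0: "U 0 = id" for s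
    using U by (auto simp: generated_group_def unitary_group_def)
  note d = xy[unfolded generated_group_iff[OF U]]
  have "((\<lambda>s. Re (cinner (U s x) (U s x))) has_vector_derivative
      Re (cinner (U 0 x) (- (\<i> *\<^sub>C y))) + Re (cinner (- (\<i> *\<^sub>C y)) (U 0 x))) (at 0)"
    by (rule bounded_bilinear.has_vector_derivative[OF bounded_bilinear_Re_cinner d d])
  then have "((\<lambda>s. Re (cinner x x)) has_vector_derivative - 2 * Re (cinner x (\<i> *\<^sub>C y))) (at 0)"
    by (simp add: unitary_opD[OF un] U0 cinner_minus_left cinner_minus_right
        Re_cinner_commute[of "\<i> *\<^sub>C y" x])
  from vector_derivative_unique_at[OF this has_vector_derivative_const] show ?thesis
    by simp
qed

text \<open>The averages \<open>(1 / e) \<integral>\<^sub>0\<^sup>e U s x ds\<close> lie in the domain and approximate \<open>x\<close>. With an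
  antiderivative \<open>g\<close> of \<open>\<lambda>s. U s x\<close> they are \<open>(g e - g 0) / e\<close>.\<close>

lemma generated_group_dense:
  fixes A :: "'a::complex_hilbert_space unbounded_op"
  assumes U: "generated_group A U"
  shows "closure (Domain A) = UNIV"
proof -
  have un: "unitary_op (U s)" and U0: "U 0 = id" and add: "U (s + t) x = U s (U t x)"
    and cont: "continuous_on UNIV (\<lambda>s. U s x)" for s t x
    using U by (auto simp: generated_group_def unitary_group_def)
  note bcl = bounded_clinearD[OF unitary_opD(1)[OF un]]
  have "x \<in> closure (Domain A)" for x
  proof -
    have "continuous_on {- 3..3} (\<lambda>s. U s x)"
      using cont continuous_on_subset by blast
    \<comment> \<open>The radii 3, 2, 1 are margins: with |s| < 2 and |h| < 1 the shifted time
      \<open>s + h\<close> stays where \<open>g\<close> is differentiable.\<close>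
    then obtain g where g': "\<And>s. s \<in> {- 3..3} \<Longrightarrow>
        (g has_vector_derivative U s x) (at s within {- 3..3})"
      using antiderivative_continuous by blast
    have g: "(g has_vector_derivative U s x) (at s)" if "s \<in> {- 3<..<3}" for s
      using g'[of s] that by (simp add: at_within_Icc_at)
    \<comment> \<open>\<open>U h\<close> translates the integral of the orbit over [0, e] to
      [h, e + h]. As functions of \<open>s\<close>, \<open>U h (g s)\<close> and
      \<open>g (s + h)\<close> have the same derivative, so their difference is constant.\<close>
    have shift: "U h (g e - g 0) = g (e + h) - g h" if "\<bar>h\<bar> < 1" "\<bar>e\<bar> < 1" for h e
    proof -
      have deriv: "((\<lambda>s. U h (g s) - g (s + h)) has_vector_derivative 0) (at s)"
        if s: "s \<in> {- 2<..<2}" for s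
      proof -
        have "((\<lambda>s. g (s + h)) has_vector_derivative U (s + h) x) (at s)"
        proof -
          have "s + h \<in> {- 3<..<3}"
            using s \<open>\<bar>h\<bar> < 1\<close> by auto
          from g[OF this] show ?thesis
            by (simp add: has_vector_derivative_at_iff_tendsto algebra_simps)
        qed
        moreover have "((\<lambda>s. U h (g s)) has_vector_derivative U h (U s x)) (at s)"
          using s by (intro bounded_linear.has_vector_derivative[OF unitary_opD(2)[OF un]] g) auto
        ultimately have "((\<lambda>s. U h (g s) - g (s + h)) has_vector_derivative
            U h (U s x) - U (s + h) x) (at s)"
          by (rule has_vector_derivative_diff[rotated])
        then show ?thesis
          by (simp add: add.commute[of s h] add)
      qed
      obtain c where c: "\<And>s. s \<in> {- 2<..<2::real} \<Longrightarrow> U h (g s) - g (s + h) = c"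
        using has_vector_derivative_zero_constant[OF convex_real_interval(8)
            has_vector_derivative_at_within[OF deriv]] by blast
      have "U h (g e) - g (e + h) = c"
        by (rule c) (use that in auto)
      moreover have "U h (g 0) - g (0 + h) = c"
        by (rule c) auto
      ultimately show ?thesis
        by (simp add: bcl algebra_simps)
    qed
    have dom: "(g e - g 0) /\<^sub>R e \<in> Domain A" if e: "\<bar>e\<bar> < 1" for e
    proof -
      \<comment> \<open>By \<open>shift\<close>, this quotient is the difference of the quotients of
        \<open>g\<close> at \<open>e\<close> and at 0.\<close>
      have lim: "(\<lambda>h. (U h (g e - g 0) - (g e - g 0)) /\<^sub>R h) \<midarrow>0\<rightarrow> U e x - x"
      proof (rule Lim_transform_eventually)
        have "e \<in> {- 3<..<3}"
          using e by auto
        from g[OF this] g[of 0]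
        have "(\<lambda>h. (g (e + h) - g e) /\<^sub>R h) \<midarrow>0\<rightarrow> U e x" "(\<lambda>h. (g (0 + h) - g 0) /\<^sub>R h) \<midarrow>0\<rightarrow> x"
          by (simp_all add: has_vector_derivative_at_iff_tendsto U0)
        from tendsto_diff[OF this]
        show "(\<lambda>h. (g (e + h) - g e) /\<^sub>R h - (g (0 + h) - g 0) /\<^sub>R h) \<midarrow>0\<rightarrow> U e x - x" .
        show "\<forall>\<^sub>F h in at 0. (g (e + h) - g e) /\<^sub>R h - (g (0 + h) - g 0) /\<^sub>R h =
            (U h (g e - g 0) - (g e - g 0)) /\<^sub>R h"
          unfolding eventually_at
          by (rule exI[of _ 1]) (auto simp: shift e dist_norm algebra_simps)
      qed
      then have "((\<lambda>s. U s (g e - g 0)) has_vector_derivative U e x - x) (at 0)"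
        by (simp add: has_vector_derivative_at_iff_tendsto U0)
      then have "((\<lambda>s. U s ((g e - g 0) /\<^sub>R e)) has_vector_derivative (U e x - x) /\<^sub>R e) (at 0)"
        using bounded_linear.has_vector_derivative[OF bounded_linear_scaleR_right]
        by (fastforce simp: bcl)
      \<comment> \<open>Brings the derivative into the form -iy, exhibiting the value y of the
        generator.\<close>
      moreover have "(U e x - x) /\<^sub>R e = - (\<i> *\<^sub>C (\<i> *\<^sub>C ((U e x - x) /\<^sub>R e)))"
        by (simp add: scaleC_scaleC scaleC_minus_left)
      ultimately show ?thesis
        using generated_group_iff[OF U] by (metis DomainI)
    qed
    have "(\<lambda>e. (g (0 + e) - g 0) /\<^sub>R e) \<midarrow>0\<rightarrow> x"
      using g[of 0] unfolding has_vector_derivative_at_iff_tendsto by (simp add: U0)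
    moreover have "\<forall>\<^sub>F e in at 0. (g (0 + e) - g 0) /\<^sub>R e \<in> closure (Domain A)"
      unfolding eventually_at
      by (rule exI[of _ 1]) (use dom closure_subset in \<open>auto simp: dist_norm\<close>)
    ultimately show ?thesis
      by (intro Lim_in_closed_set[OF closed_closure]) auto
  qed
  then show ?thesis
    by blast
qed

text \<open>On the domain, \<open>w s = u (U s x) - U s (u x)\<close> solves \<open>w' = - \<i> A w\<close> with \<open>w 0 = 0\<close>, and
  symmetry of \<open>A\<close> makes its norm constant.\<close>

lemma generated_group_commute:
  fixes A :: "'a::complex_hilbert_space unbounded_op"
  assumes U: "generated_group A U" and u: "bounded_clinear u"
    and inv: "\<And>x y. (x, y) \<in> A \<Longrightarrow> (u x, u y) \<in> A"
  shows "u (U t x) = U t (u x)"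
proof -
  have un: "unitary_op (U s)" and U0: "U 0 = id" for s
    using U by (auto simp: generated_group_def unitary_group_def)
  have ul: "bounded_linear u"
    using u by (simp add: bounded_clinear_def)
  have "u (U t x) = U t (u x)" if x: "x \<in> Domain A" for x
  proof -
    obtain y where xy: "(x, y) \<in> A"
      using x by auto
    define w where "w s = u (U s x) - U s (u x)" for s
    define v where "v s = u (U s y) - U s (u y)" for s
    have wv: "(w s, v s) \<in> A" for s
      unfolding w_def v_def using U xy
      by (intro generated_group_diff[OF U] inv generated_group_invariant[OF U]) auto
    have w': "(w has_vector_derivative - (\<i> *\<^sub>C v s)) (at s)" for s
    proof -
      have "u (- (\<i> *\<^sub>C U s y)) = - (\<i> *\<^sub>C u (U s y))"
        using bounded_clinearD(2)[OF u, of "- \<i>"] by (simp add: scaleC_minus_left)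
      then have "((\<lambda>s. u (U s x)) has_vector_derivative - (\<i> *\<^sub>C u (U s y))) (at s)"
        using bounded_linear.has_vector_derivative[OF ul
            generated_group_has_vector_derivative[OF U xy, of s]] by simp
      from has_vector_derivative_diff[OF this
          generated_group_has_vector_derivative[OF U inv[OF xy], of s]]
      show ?thesis
        by (simp add: w_def[abs_def] v_def scaleC_diff_right)
    qed
    have "((\<lambda>s. Re (cinner (w s) (w s))) has_vector_derivative 0) (at s)" for s
    proof -
      have "Re (cinner (w s) (- (\<i> *\<^sub>C v s))) + Re (cinner (- (\<i> *\<^sub>C v s)) (w s)) = 0"
        using generated_group_symmetric[OF U wv[of s]] Re_cinner_commute[of "\<i> *\<^sub>C v s" "w s"]
        by (simp only: cinner_minus_left cinner_minus_right) simp
      then show ?thesis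
        using bounded_bilinear.has_vector_derivative[OF bounded_bilinear_Re_cinner w' w', of s]
        by simp
    qed
    then obtain c where c: "\<And>s. Re (cinner (w s) (w s)) = c"
      using has_vector_derivative_zero_constant[OF convex_UNIV, of "\<lambda>s. Re (cinner (w s) (w s))"]
      by auto
    have "w 0 = 0"
      by (simp add: w_def U0)
    then have "Re (cinner (w t) (w t)) = 0"
      using c[of 0] c[of t] by simp
    then show ?thesis
      by (simp add: cinner_self w_def)
  qed
  \<comment> \<open>Both sides are continuous in \<open>x\<close>, so the identity passes from the
    dense domain to the whole space.\<close>
  moreover have "closed {x. u (U t x) = U t (u x)}"
    by (intro closed_Collect_eq linear_continuous_on
        bounded_linear_compose[OF ul] bounded_linear_compose[OF unitary_opD(2)[OF un]]
        ul unitary_opD(2)[OF un])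
  ultimately have "closure (Domain A) \<subseteq> {x. u (U t x) = U t (u x)}"
    by (intro closure_minimal) auto
  then show ?thesis
    unfolding generated_group_dense[OF U] by blast
qed


section \<open>Invariance of the Hamiltonians and the conserved quantity\<close>

lemma closure_invariant:
  fixes u :: "'a::topological_space \<Rightarrow> 'a"
  assumes u: "continuous_on UNIV u" and inv: "\<And>x y. (x, y) \<in> S \<Longrightarrow> (u x, u y) \<in> S"
    and xy: "(x, y) \<in> closure S"
  shows "(u x, u y) \<in> closure S"
proof -
  have "continuous_on UNIV (\<lambda>p. (u (fst p), u (snd p)))"
    by (intro continuous_intros continuous_on_compose2[OF u]) auto
  then have "(\<lambda>p. (u (fst p), u (snd p))) ` closure S \<subseteq> closure S"
    using inv closure_subset[of S]
    by (intro image_closure_subset) (auto intro: continuous_on_subset)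
  then show ?thesis
    using xy by force
qed

text \<open>The left composition contains \<open>(x, u y)\<close>; membership of this pair in the
  right one means precisely that \<open>(u x, u y)\<close> lies in \<open>A\<close>.\<close>

lemma affiliated_invariant:
  assumes "A \<in> L\<^sup>0 M" "u \<in> commutant M" "unitary_op u" "(x, y) \<in> A"
  shows "(u x, u y) \<in> A"
proof -
  have eq: "A O op_graph u = op_graph u O A"
    using assms by (auto simp: affiliated_operators_def)
  have "(x, u y) \<in> A O op_graph u"
    using assms(4) by (auto simp: op_graph_def)
  then show ?thesis
    unfolding eq by (auto simp: op_graph_def)
qed

text \<open>Invariance of graphs passes through pointwise sums and multiples by linearity of
  \<open>u\<close>, and through the closures in the strong operations by continuity.\<close>

lemma hamiltonian_invariant:
  assumes V: "\<And>j x y. j \<le> n \<Longrightarrow> (x, y) \<in> V j \<Longrightarrow> (u x, u y) \<in> V j"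
    and u: "bounded_clinear u" and "(x, y) \<in> hamiltonian V c n"
  shows "(u x, u y) \<in> hamiltonian V c n"
  using V assms(3)
proof (induction n arbitrary: x y)
  case 0
  then show ?case
    by simp
next
  case (Suc n)
  have cont: "continuous_on UNIV u"
    using u by (auto simp: bounded_clinear_def linear_continuous_on)
  define d where "d = complex_of_real (c (Suc n))"
  have scale: "(u x, u y) \<in> strong_scale d (V (Suc n))"
    if "(x, y) \<in> strong_scale d (V (Suc n))" for x y
    using that unfolding strong_scale_def
    by (rule closure_invariant[OF cont, rotated])
      (use Suc.prems(1)[OF order_refl] in \<open>auto simp: bounded_clinearD[OF u]\<close>)
  have IH: "(u x, u y) \<in> hamiltonian V c n" if "(x, y) \<in> hamiltonian V c n" for x y
    by (rule Suc.IH[OF _ that]) (use Suc.prems(1) in auto)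
  have "(u x, u y) \<in> strong_sum (hamiltonian V c n) (strong_scale d (V (Suc n)))"
    using Suc.prems(2) unfolding strong_sum_def hamiltonian.simps d_def[symmetric]
    by (rule closure_invariant[OF cont, rotated])
      (use IH scale in \<open>force simp: bounded_clinearD[OF u]\<close>)
  then show ?case
    by (simp add: d_def)
qed

text \<open>Whatever the control values on a piece, their Hamiltonian is invariant under
  \<open>u\<close>, so each exponential factor is isometric and commutes with \<open>u\<close>.
  Together the two claims preserve <x, u x>.\<close>

lemma propagator_unitary_commute:
  assumes "propagator hbar V N c t P"
    and V: "\<And>j x y. j \<le> N \<Longrightarrow> (x, y) \<in> V j \<Longrightarrow> (u x, u y) \<in> V j"
    and u: "bounded_clinear u"
  shows "cinner (P x) (P y) = cinner x y \<and> u (P x) = P (u x)"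
  using assms(1)
proof (induction arbitrary: x y)
  case start
  then show ?case
    by simp
next
  case (piece t P t' q W)
  then obtain U where U: "generated_group (hamiltonian V q N) U" "W = U ((t' - t) / hbar)"
    by (auto simp: is_exp_def)
  have "unitary_op W"
    using U by (auto simp: generated_group_def unitary_group_def)
  moreover have "u (W x) = W (u x)" for x
    unfolding U(2) by (rule generated_group_commute[OF U(1) u]) (rule hamiltonian_invariant[OF V u])
  ultimately show ?case
    using piece.IH by (simp add: unitary_opD)
qed

theorem corollary4p11:
  fixes M :: "('a::complex_hilbert_space \<Rightarrow> 'a) set"
    and \<tau> :: "('a \<Rightarrow> 'a) \<Rightarrow> complex"
    and V :: "nat \<Rightarrow> 'a unbounded_op"
    and N :: nat
    and hbar :: real
  assumes "separable_space (euclidean :: 'a topology)"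
    and "infinite_dimensional TYPE('a)"
    and "finite_von_neumann_algebra M \<tau>"
    and "\<And>j. j \<le> N \<Longrightarrow> V j \<in> L\<^sup>0 M"
    and "\<And>j. j \<le> N \<Longrightarrow> self_adjoint (V j)"
    and "hbar > 0"
    and "\<not> factor M"
  shows "\<not> pure_state_controllable hbar V N"
proof
  assume ctrl: "pure_state_controllable hbar V N"
  have "von_neumann_algebra M"
    using assms(3) by (simp add: finite_von_neumann_algebra_def)
  then obtain u where u: "u \<in> commutant M" "unitary_op u" "\<nexists>c. u = (\<lambda>x. c *\<^sub>C x)"
    using not_factor_nonscalar_unitary assms(7) by blast
  note ub = unitary_opD(1)[OF u(2)]
  have conserved: "cinner y (u y) = cinner x (u x)" if xy: "norm x = 1" "norm y = 1" for x y
  proof -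
    obtain c T \<xi> where "T > 0" "solution hbar V N c x \<xi>" "\<xi> T = y"
      using ctrl xy unfolding pure_state_controllable_def by blast
    then obtain P where P: "propagator hbar V N c T P" "y = P x"
      unfolding solution_def by (metis less_imp_le)
    \<comment> \<open>Gives <Px, u P x> = <Px, P u x> = <x, u x>.\<close>
    note PU = propagator_unitary_commute[OF P(1) affiliated_invariant[OF assms(4) u(1,2)] ub]
    show ?thesis
      unfolding P(2) using PU by simp
  qed
  define a where "a x = (1 / norm x) *\<^sub>R x" for x :: 'a
  \<comment> \<open>On the trivial space every map would be scalar, so non-scalarity of
    \<open>u\<close> supplies a nonzero vector.\<close>
  obtain e :: 'a where e: "e \<noteq> 0"
    using u(3) by (metis (full_types))
  define c where "c = cinner (a e) (u (a e))"
  \<comment> \<open>\<open>c\<close> is the common value of the form on the unit sphere; homogeneity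
    of degree two extends this to all \<open>x\<close>, and polarization then forces
    \<open>u\<close> to be the scalar \<open>c\<close>.\<close>
  have form: "cinner x (u x - c *\<^sub>C x) = 0" for x
  proof (cases "x = 0")
    case False
    then have "cinner (a x) (u (a x)) = c"
      unfolding c_def by (intro conserved) (use e in \<open>simp_all add: a_def\<close>)
    moreover have x: "x = complex_of_real (norm x) *\<^sub>C a x"
      using False by (simp add: a_def flip: scaleR_scaleC)
    have "cinner x (u x) = complex_of_real ((norm x)\<^sup>2) * cinner (a x) (u (a x))"
      by (subst (1 2) x) (simp add: bounded_clinearD[OF ub] cinner_simps power2_eq_square)
    ultimately show ?thesis
      by (simp add: cinner_simps cinner_self)
  qed simp
  have "u x - c *\<^sub>C x = 0" for x
    by (rule quadratic_form_eq_zero[OF _ _ form])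
      (simp_all add: bounded_clinearD[OF ub] scaleC_add_right scaleC_diff_right scaleC_scaleC
        mult.commute)
  then show False
    using u(3) by (metis eq_iff_diff_eq_0)
qed

end
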